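(* Let $\mathfrak{SC}$ be a sequent calculus having the identity axiom and the structural rules of weakening and contraction (left and right), and suppose that $$\frac{S\cup\{\Rightarrow\varphi\}}{\Sigma}\qquad\text{and}\qquad\frac{S\cup\{\varphi\Rightarrow\}}{\Sigma}$$ are two context-free rules of $\mathfrak{SC}$. Then the rule $\dfrac{S}{\Sigma}$ is derivable in $\mathfrak{SC}$.
   Context: Sequents are ordinary two-sided sequents $\Gamma\Rightarrow\Delta$ with $\Gamma,\Delta$ finite (possibly empty) sets of formulas. The identity axiom is $\varphi\Rightarrow\varphi$ for every formula $\varphi$. Here $S$ is a finite set of sequents (sequent schemes), $\Sigma$ a sequent (scheme), $\varphi$ a formula (scheme); a rule $\frac{S}{\Sigma}$ has the members of $S$ as premises (upper sequents) and $\Sigma$ as conclusion (lower sequent). A rule (r) is context-free if whenever $\frac{\Gamma_1\Rightarrow\Delta_1\ \dots\ \Gamma_k\Rightarrow\Delta_k}{\Gamma\Rightarrow\Delta}$ is a valid application of (r) and $\Gamma',\Delta'$ are sets of formulas, then $\frac{\Gamma_1,\Gamma'\Rightarrow\Delta_1,\Delta'\ \dots\ \Gamma_k,\Gamma'\Rightarrow\Delta_k,\Delta'}{\Gamma,\Gamma'\Rightarrow\Delta,\Delta'}$ is also a valid application of (r). A rule $\frac{S}{\Sigma}$ is derivable in $\mathfrak{SC}$ if (for each instance) $\Sigma$ can be derived from the sequents in $S$ using the axioms and rules of $\mathfrak{SC}$. *)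

theory Defs
  imports Main "HOL-Library.FSet"
begin

datatype 'f sequent = Sequent "'f fset" "'f fset" (infix "\<turnstile>" 50)

text \<open>
  A rule is the set of its valid applications, each a pair of a finite set of upper sequents
  and a lower sequent.
\<close>

type_synonym 'f rule = "('f sequent fset \<times> 'f sequent) set"

record 'f calculus =
  axioms :: "'f sequent set"
  rules :: "'f rule set"

inductive derivable_from :: "'f calculus \<Rightarrow> 'f sequent fset \<Rightarrow> 'f sequent \<Rightarrow> bool"
  for SC :: "'f calculus" and P :: "'f sequent fset" where
  hypothesis: "s |\<in>| P \<Longrightarrow> derivable_from SC P s"
| "axiom": "s \<in> axioms SC \<Longrightarrow> derivable_from SC P s"
| application: "\<lbrakk>r \<in> rules SC; (Q, s) \<in> r; \<And>q. q |\<in>| Q \<Longrightarrow> derivable_from SC P q\<rbrakk>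
    \<Longrightarrow> derivable_from SC P s"

definition derivable_rule :: "'f calculus \<Rightarrow> 'f rule \<Rightarrow> bool" where
  "derivable_rule SC r \<longleftrightarrow> (\<forall>(P, s) \<in> r. derivable_from SC P s)"

definition weakening_left :: "'f rule" where
  "weakening_left = {({|\<Gamma> \<turnstile> \<Delta>|}, finsert \<psi> \<Gamma> \<turnstile> \<Delta>) |\<psi> \<Gamma> \<Delta>. True}"

definition weakening_right :: "'f rule" where
  "weakening_right = {({|\<Gamma> \<turnstile> \<Delta>|}, \<Gamma> \<turnstile> finsert \<psi> \<Delta>) |\<psi> \<Gamma> \<Delta>. True}"

text \<open>Since sequents are built from sets, the premise and conclusion of a contraction coincide.\<close>

definition contraction_left :: "'f rule" where
  "contraction_left =
    {({|finsert \<psi> (finsert \<psi> \<Gamma>) \<turnstile> \<Delta>|}, finsert \<psi> \<Gamma> \<turnstile> \<Delta>) |\<psi> \<Gamma> \<Delta>. True}"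

definition contraction_right :: "'f rule" where
  "contraction_right =
    {({|\<Gamma> \<turnstile> finsert \<psi> (finsert \<psi> \<Delta>)|}, \<Gamma> \<turnstile> finsert \<psi> \<Delta>) |\<psi> \<Gamma> \<Delta>. True}"

fun add_context :: "'f fset \<Rightarrow> 'f fset \<Rightarrow> 'f sequent \<Rightarrow> 'f sequent" where
  "add_context \<Gamma>' \<Delta>' (\<Gamma> \<turnstile> \<Delta>) = (\<Gamma> |\<union>| \<Gamma>' \<turnstile> \<Delta> |\<union>| \<Delta>')"

definition context_free :: "'f rule \<Rightarrow> bool" where
  "context_free r \<longleftrightarrow> (\<forall>P s \<Gamma>' \<Delta>'.
    (P, s) \<in> r \<longrightarrow> (add_context \<Gamma>' \<Delta>' |`| P, add_context \<Gamma>' \<Delta>' s) \<in> r)"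

definition context_closure :: "'f rule \<Rightarrow> 'f rule" where
  "context_closure r =
    {(add_context \<Gamma>' \<Delta>' |`| P, add_context \<Gamma>' \<Delta>' s) |P s \<Gamma>' \<Delta>'. (P, s) \<in> r}"

text \<open>
  Schemes are represented by their instances, so that no formula language has to be fixed:
  with \<open>'i\<close> the type of instantiations of the schematic letters (formula letters, and context
  letters if there are any), a formula scheme is a function \<open>'i \<Rightarrow> 'f\<close> and a sequent scheme a
  function \<open>'i \<Rightarrow> 'f sequent\<close>. All schemes of a rule are instantiated simultaneously. Single
  formulas and sequents are the constant schemes.
\<close>

type_synonym ('i, 'f) sequent_scheme = "'i \<Rightarrow> 'f sequent"

definition instances :: "('i, 'f) sequent_scheme fset \<Rightarrow> ('i, 'f) sequent_scheme \<Rightarrow> 'f rule" where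
  "instances S \<Sigma> = range (\<lambda>i. ((\<lambda>s. s i) |`| S, \<Sigma> i))"

text \<open>
  In a displayed rule \<open>S / \<Sigma>\<close> side contexts are left implicit. The bare instances of a rule with
  a premise \<open>\<Rightarrow> \<phi>\<close> are never closed under adding contexts, so a context-free rule displayed in
  this way must have further applications besides them; the least such rule is the
  \<open>context_closure\<close> of the instances.
\<close>

definition context_free_rule_of ::
  "'f calculus \<Rightarrow> ('i, 'f) sequent_scheme fset \<Rightarrow> ('i, 'f) sequent_scheme \<Rightarrow> bool" where
  "context_free_rule_of SC S \<Sigma> \<longleftrightarrow> (\<exists>r \<in> rules SC. context_free r \<and> instances S \<Sigma> \<subseteq> r)"

end

theory Submission imports Defs begin

text \<open>
  The formula \<open>\<phi>\<close> is eliminated without a cut, by a suitable choice of the contexts in which the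
  two rules are applied.
  Let \<open>\<Sigma> = \<Gamma> \<Rightarrow> \<Delta>\<close>. Adding \<open>\<phi>\<close> to the left context of
  the first rule turns its premise \<open>\<Rightarrow> \<phi>\<close> into the identity axiom and its remaining premises into
  weakenings of \<open>S\<close>, so \<open>\<phi>, \<Gamma> \<Rightarrow> \<Delta>\<close> is derivable. Adding \<open>\<Gamma>\<close> and \<open>\<Delta>\<close> to the context of the second
  rule turns its premise \<open>\<phi> \<Rightarrow>\<close> into this very sequent, its remaining premises again into
  weakenings of \<open>S\<close>, and its conclusion into \<open>\<Gamma>, \<Gamma> \<Rightarrow> \<Delta>, \<Delta>\<close>, which is \<open>\<Gamma> \<Rightarrow> \<Delta>\<close> by contraction, or
  directly because the sides of a sequent are sets. This is the content of
  \<open>derivable_from_complementary_premises\<close>.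
\<close>

lemma derivable_from_weakening_left:
  assumes "weakening_left \<in> rules SC" and "derivable_from SC P (\<Gamma> \<turnstile> \<Delta>)"
  shows "derivable_from SC P (\<Gamma> |\<union>| \<Gamma>' \<turnstile> \<Delta>)"
proof (induction \<Gamma>')
  case empty
  show ?case using assms(2) by simp
next
  case (insert \<psi> \<Gamma>')
  have "({|\<Gamma> |\<union>| \<Gamma>' \<turnstile> \<Delta>|}, \<Gamma> |\<union>| finsert \<psi> \<Gamma>' \<turnstile> \<Delta>) \<in> weakening_left"
    by (auto simp: weakening_left_def)
  then show ?case
    using assms(1) insert.IH by (auto intro: derivable_from.application)
qed

lemma derivable_from_weakening_right:
  assumes "weakening_right \<in> rules SC" and "derivable_from SC P (\<Gamma> \<turnstile> \<Delta>)"
  shows "derivable_from SC P (\<Gamma> \<turnstile> \<Delta> |\<union>| \<Delta>')"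
proof (induction \<Delta>')
  case empty
  show ?case using assms(2) by simp
next
  case (insert \<psi> \<Delta>')
  have "({|\<Gamma> \<turnstile> \<Delta> |\<union>| \<Delta>'|}, \<Gamma> \<turnstile> \<Delta> |\<union>| finsert \<psi> \<Delta>') \<in> weakening_right"
    by (auto simp: weakening_right_def)
  then show ?case
    using assms(1) insert.IH by (auto intro: derivable_from.application)
qed

lemma derivable_from_add_context:
  assumes "weakening_left \<in> rules SC" "weakening_right \<in> rules SC"
    and "derivable_from SC P s"
  shows "derivable_from SC P (add_context \<Gamma>' \<Delta>' s)"
  using assms by (cases s) (auto intro: derivable_from_weakening_left derivable_from_weakening_right)

lemma derivable_from_context_free_rule:
  assumes "r \<in> rules SC" and "context_free r" and "(Q, s) \<in> r"
    and "\<And>q. q |\<in>| Q \<Longrightarrow> derivable_from SC P (add_context \<Gamma>' \<Delta>' q)"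
  shows "derivable_from SC P (add_context \<Gamma>' \<Delta>' s)"
proof (rule derivable_from.application[OF assms(1)])
  show "(add_context \<Gamma>' \<Delta>' |`| Q, add_context \<Gamma>' \<Delta>' s) \<in> r"
    using assms(2,3) by (auto simp: context_free_def)
qed (use assms(4) in auto)

text \<open>
  The distinguished premises \<open>\<Rightarrow> \<psi>\<close> and \<open>\<psi> \<Rightarrow>\<close> carry a context \<open>\<Gamma>'\<close>, \<open>\<Delta>'\<close>, so that the lemma applies to the bare
  instances of a rule and to those with side formulas alike.
\<close>

lemma derivable_from_complementary_premises:
  assumes identity: "({|\<psi>|} \<turnstile> {|\<psi>|}) \<in> axioms SC"
    and weakening: "weakening_left \<in> rules SC" "weakening_right \<in> rules SC"
    and r: "r \<in> rules SC" "context_free r" "(finsert (\<Gamma>' \<turnstile> finsert \<psi> \<Delta>') Q, s) \<in> r"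
    and r': "r' \<in> rules SC" "context_free r'" "(finsert (finsert \<psi> \<Gamma>' \<turnstile> \<Delta>') Q, s) \<in> r'"
    and side: "\<And>q. q |\<in>| Q \<Longrightarrow> derivable_from SC P q"
  shows "derivable_from SC P s"
proof -
  obtain \<Gamma> \<Delta> where s: "s = (\<Gamma> \<turnstile> \<Delta>)" by (cases s)
  note weaken = derivable_from_add_context[OF weakening]
  have "derivable_from SC P (add_context {|\<psi>|} {||} s)"
  proof (rule derivable_from_context_free_rule[OF r])
    fix q assume "q |\<in>| finsert (\<Gamma>' \<turnstile> finsert \<psi> \<Delta>') Q"
    moreover have "derivable_from SC P (add_context {|\<psi>|} {||} (\<Gamma>' \<turnstile> finsert \<psi> \<Delta>'))"
      using weaken[OF derivable_from.axiom[OF identity], of P \<Gamma>' \<Delta>'] by simp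
    ultimately show "derivable_from SC P (add_context {|\<psi>|} {||} q)"
      using weaken side by auto
  qed
  then have conclusion_with_formula: "derivable_from SC P (finsert \<psi> \<Gamma> \<turnstile> \<Delta>)"
    by (simp add: s)
  have "derivable_from SC P (add_context \<Gamma> \<Delta> s)"
  proof (rule derivable_from_context_free_rule[OF r'])
    fix q assume "q |\<in>| finsert (finsert \<psi> \<Gamma>' \<turnstile> \<Delta>') Q"
    moreover have "derivable_from SC P (add_context \<Gamma> \<Delta> (finsert \<psi> \<Gamma>' \<turnstile> \<Delta>'))"
      using weaken[OF conclusion_with_formula, of \<Gamma>' \<Delta>'] by (simp add: sup_commute)
    ultimately show "derivable_from SC P (add_context \<Gamma> \<Delta> q)"
      using weaken side by auto
  qed
  then show ?thesis by (simp add: s)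
qed

lemma add_context_empty: "add_context {||} {||} = (\<lambda>s. s)"
proof
  show "add_context {||} {||} s = s" for s :: "'f sequent"
    by (cases s) simp
qed

lemma subset_context_closure: "r \<subseteq> context_closure r"
proof clarify
  fix P s assume "(P, s) \<in> r"
  moreover have "P = add_context {||} {||} |`| P" "s = add_context {||} {||} s"
    by (simp_all add: add_context_empty)
  ultimately show "(P, s) \<in> context_closure r"
    unfolding context_closure_def by blast
qed

theorem proposition5p1:
  fixes SC :: "'f calculus"
    and S :: "('i, 'f) sequent_scheme fset"
    and \<Sigma> :: "('i, 'f) sequent_scheme"
    and \<phi> :: "'i \<Rightarrow> 'f"
  assumes identity: "\<And>\<psi>. ({|\<psi>|} \<turnstile> {|\<psi>|}) \<in> axioms SC"
    and weakening: "weakening_left \<in> rules SC" "weakening_right \<in> rules SC"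
    and contraction: "contraction_left \<in> rules SC" "contraction_right \<in> rules SC"
    and rule_right: "context_free_rule_of SC (S |\<union>| {|\<lambda>i. {||} \<turnstile> {|\<phi> i|}|}) \<Sigma>"
    and rule_left: "context_free_rule_of SC (S |\<union>| {|\<lambda>i. {|\<phi> i|} \<turnstile> {||}|}) \<Sigma>"
  shows "derivable_rule SC (instances S \<Sigma>) \<and>
    derivable_rule SC (context_closure (instances S \<Sigma>))"
proof -
  obtain r where r: "r \<in> rules SC" "context_free r"
    and inst: "instances (S |\<union>| {|\<lambda>i. {||} \<turnstile> {|\<phi> i|}|}) \<Sigma> \<subseteq> r"
    using rule_right by (auto simp: context_free_rule_of_def)
  obtain r' where r': "r' \<in> rules SC" "context_free r'"
    and inst': "instances (S |\<union>| {|\<lambda>i. {|\<phi> i|} \<turnstile> {||}|}) \<Sigma> \<subseteq> r'"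
    using rule_left by (auto simp: context_free_rule_of_def)
  have closure: "derivable_rule SC (context_closure (instances S \<Sigma>))"
    unfolding derivable_rule_def
  proof clarify
    fix P s assume "(P, s) \<in> context_closure (instances S \<Sigma>)"
    then obtain i \<Gamma>' \<Delta>' where P: "P = add_context \<Gamma>' \<Delta>' |`| (\<lambda>s. s i) |`| S"
      and s: "s = add_context \<Gamma>' \<Delta>' (\<Sigma> i)"
      by (auto simp: context_closure_def instances_def)
    have "(finsert ({||} \<turnstile> {|\<phi> i|}) ((\<lambda>s. s i) |`| S), \<Sigma> i) \<in> r"
      using inst by (auto simp: instances_def)
    then have app: "(finsert (\<Gamma>' \<turnstile> finsert (\<phi> i) \<Delta>') P, s) \<in> r"
      using r(2) by (fastforce simp: context_free_def P s)
    have "(finsert ({|\<phi> i|} \<turnstile> {||}) ((\<lambda>s. s i) |`| S), \<Sigma> i) \<in> r'"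
      using inst' by (auto simp: instances_def)
    then have app': "(finsert (finsert (\<phi> i) \<Gamma>' \<turnstile> \<Delta>') P, s) \<in> r'"
      using r'(2) by (fastforce simp: context_free_def P s)
    show "derivable_from SC P s"
      using identity weakening r app r' app' derivable_from.hypothesis
      by (rule derivable_from_complementary_premises)
  qed
  then have "derivable_rule SC (instances S \<Sigma>)"
    using subset_context_closure by (fastforce simp: derivable_rule_def)
  with closure show ?thesis by simp
qed

end
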